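(* Let $N\ge 1$, let $\varepsilon>0$, and let $x_1<x_2<\cdots<x_N$ and $y_1<y_2<\cdots<y_N$ be real numbers. Let $\zeta$ be the dividing index of these meshes and let $K_U=[\hat k_{ij}]\in\mathbb{R}^{N\times N}$ be the upper block induced by $\zeta$. Define the ratio vector $\boldsymbol r'=(r'_1,\dots,r'_{N-1})\in\mathbb{R}^{N-1}$ by $$r'_i=\frac{\hat k_{i,N}}{\hat k_{i+1,N}},\qquad i=1,\dots,N-1,$$ with the convention $r'_i=1$ if $\hat k_{i+1,N}=0$, and define the block-edge (row) vectors $$\boldsymbol\eta'_i=[\hat k_{i,\zeta(i)+1},\dots,\hat k_{i,\zeta(i+1)}],\qquad i=1,\dots,N,$$ with the convention $\zeta(N+1)=N$ ($\boldsymbol\eta'_i$ is empty when $\zeta(i)=\zeta(i+1)$). Then the vectors $\boldsymbol\eta'_1,\dots,\boldsymbol\eta'_N$ have a total of $N-\zeta(1)$ entries, and $K_U$ has the representation $$K_U=\begin{pmatrix}\ &\boldsymbol\eta'_1&\cdots&\cdots&\prod_{t=1}^{N-2}r'_t\,\boldsymbol\eta'_{N-1}&\prod_{t=1}^{N-1}r'_t\,\boldsymbol\eta'_N\\ &&\ddots&\vdots&\vdots&\vdots\\ &&&\boldsymbol\eta'_{N-2}&r'_{N-2}\boldsymbol\eta'_{N-1}&r'_{N-2}r'_{N-1}\boldsymbol\eta'_N\\ &&&&\boldsymbol\eta'_{N-1}&r'_{N-1}\boldsymbol\eta'_N\\ &&&&&\boldsymbol\eta'_N\end{pmatrix},$$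 where blank positions are zero. That is, for all $1\le i,s\le N$, the restriction of row $i$ of $K_U$ to the columns $\zeta(s)+1,\dots,\zeta(s+1)$ equals $\bigl(\prod_{t=i}^{s-1}r'_t\bigr)\boldsymbol\eta'_s$ if $s\ge i$ (empty product $=1$) and equals $0$ if $s<i$, and all columns of $K_U$ with index at most $\zeta(1)$ are zero.
   Context: The dividing index of the sorted meshes $x_1<\cdots<x_N$, $y_1<\cdots<y_N$ is the map $\zeta:\{1,\dots,N\}\to\{0,1,\dots,N\}$ defined as follows: if $y_1\le x_i<y_N$, then $\zeta(i)$ is the unique index with $y_{\zeta(i)}\le x_i<y_{\zeta(i)+1}$; if $x_i<y_1$, then $\zeta(i)=0$; if $x_i\ge y_N$, then $\zeta(i)=N$. The kernel matrix is $K=[k_{ij}]\in\mathbb{R}^{N\times N}$ with $k_{ij}=e^{-|x_i-y_j|/\varepsilon}$. The upper block $K_U=[\hat k_{ij}]\in\mathbb{R}^{N\times N}$ induced by $\zeta$ is defined by $\hat k_{ij}=0$ for $1\le j\le\zeta(i)$ and $\hat k_{ij}=k_{ij}=e^{-(y_j-x_i)/\varepsilon}$ for $\zeta(i)<j\le N$. *)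

theory Defs
  imports Complex_Main "Jordan_Normal_Form.Matrix"
begin

text \<open>
  Meshes are functions \<open>x, y :: nat \<Rightarrow> real\<close> of which only the values at \<open>1, \<dots>, N\<close> are used.
  Library matrices are indexed from 0, so \<open>entry A i j\<close> is the entry in the usual 1-based numbering.
\<close>

definition entry :: "'a mat \<Rightarrow> nat \<Rightarrow> nat \<Rightarrow> 'a" where
  "entry A i j = A $$ (i - 1, j - 1)"

text \<open>The entries of row \<open>i\<close> in the columns \<open>a, \<dots>, b\<close> (1-based, empty if \<open>b < a\<close>).\<close>

definition row_segment :: "'a mat \<Rightarrow> nat \<Rightarrow> nat \<Rightarrow> nat \<Rightarrow> 'a list" where
  "row_segment A i a b = map (entry A i) [a..<b + 1]"

text \<open>
  The branches after the first are the dividing index proper, on \<open>1, \<dots>, N\<close>; the first is the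
  convention that its value at \<open>N + 1\<close> is \<open>N\<close>.
\<close>

definition dividing_index :: "nat \<Rightarrow> (nat \<Rightarrow> real) \<Rightarrow> (nat \<Rightarrow> real) \<Rightarrow> nat \<Rightarrow> nat" where
  "dividing_index N x y i =
     (if i = N + 1 then N
      else if x i < y 1 then 0
      else if x i \<ge> y N then N
      else (THE l. 1 \<le> l \<and> l + 1 \<le> N \<and> y l \<le> x i \<and> x i < y (l + 1)))"

definition kernel_matrix :: "nat \<Rightarrow> real \<Rightarrow> (nat \<Rightarrow> real) \<Rightarrow> (nat \<Rightarrow> real) \<Rightarrow> real mat" where
  "kernel_matrix N \<epsilon> x y = mat N N (\<lambda>(i, j). exp (- \<bar>x (i + 1) - y (j + 1)\<bar> / \<epsilon>))"

definition upper_block :: "nat \<Rightarrow> real \<Rightarrow> (nat \<Rightarrow> real) \<Rightarrow> (nat \<Rightarrow> real) \<Rightarrow> real mat" where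
  "upper_block N \<epsilon> x y =
     mat N N (\<lambda>(i, j). if j + 1 \<le> dividing_index N x y (i + 1) then 0
                       else kernel_matrix N \<epsilon> x y $$ (i, j))"

definition upper_ratio :: "nat \<Rightarrow> real \<Rightarrow> (nat \<Rightarrow> real) \<Rightarrow> (nat \<Rightarrow> real) \<Rightarrow> nat \<Rightarrow> real" where
  "upper_ratio N \<epsilon> x y i =
     (if entry (upper_block N \<epsilon> x y) (i + 1) N = 0 then 1
      else entry (upper_block N \<epsilon> x y) i N / entry (upper_block N \<epsilon> x y) (i + 1) N)"

definition upper_edge :: "nat \<Rightarrow> real \<Rightarrow> (nat \<Rightarrow> real) \<Rightarrow> (nat \<Rightarrow> real) \<Rightarrow> nat \<Rightarrow> real list" where
  "upper_edge N \<epsilon> x y i =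
     row_segment (upper_block N \<epsilon> x y) i
       (dividing_index N x y i + 1) (dividing_index N x y (i + 1))"

text \<open>
  The block upper triangular matrix with \<open>N\<close> rows and columns built from the ratios \<open>r\<close> and the row
  vectors \<open>\<eta>\<close>: row \<open>i\<close> consists of \<open>m\<close> zeros followed by the blocks \<open>s = 1, \<dots>, N\<close>, where block \<open>s\<close>
  is \<open>r i * \<dots> * r (s - 1)\<close> times \<open>\<eta> s\<close> if \<open>i \<le> s\<close>, and a zero block of the same length otherwise.
\<close>

definition block_triangular ::
    "nat \<Rightarrow> nat \<Rightarrow> (nat \<Rightarrow> real) \<Rightarrow> (nat \<Rightarrow> real list) \<Rightarrow> real mat" where
  "block_triangular N m r \<eta> =
     mat_of_rows_list N
       (map (\<lambda>i. replicate m 0 @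
              concat (map (\<lambda>s. if i \<le> s then map (\<lambda>c. (\<Prod>t = i..<s. r t) * c) (\<eta> s)
                                else replicate (length (\<eta> s)) 0) [1..<N + 1]))
         [1..<N + 1])"

end

theory Submission
  imports Defs
begin

text \<open>
  For \<open>i, j\<close> in \<open>1, \<dots>, N\<close> one has \<open>j \<le> \<zeta>(i)\<close> iff \<open>y j \<le> x i\<close>. Hence \<open>\<zeta>\<close> is monotone, the blocks
  of columns between consecutive values of \<open>\<zeta>\<close> tile the columns after \<open>\<zeta>(1)\<close>, and the nonzero
  entries of the upper block are the separable quantities \<open>exp (x i / \<epsilon>) * exp (- y j / \<epsilon>)\<close>. If
  a column \<open>j\<close> lies to the right of \<open>\<zeta>(s)\<close>, then \<open>x s < y j \<le> y N\<close>, so the last entries of the rows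
  \<open>1, \<dots>, s\<close> do not vanish and the ratios \<open>r t = exp ((x t - x (t + 1)) / \<epsilon>)\<close> telescope from row
  \<open>i \<le> s\<close> to row \<open>s\<close>.
\<close>

lemma concat_map_upt_mono_on:
  fixes z :: "nat \<Rightarrow> nat"
  assumes "mono_on {m..n} z" and "m \<le> n"
  shows "concat (map (\<lambda>s. [z s..<z (Suc s)]) [m..<n]) = [z m..<z n]"
  using assms(2,1)
proof (induction n rule: dec_induct)
  case base
  show ?case by simp
next
  case (step n)
  have "z m \<le> z n" "z n \<le> z (Suc n)"
    using step.hyps by (auto intro: mono_onD[OF step.prems])
  then have "[z m..<z n] @ [z n..<z (Suc n)] = [z m..<z (Suc n)]"
    by (metis le_add_diff_inverse upt_add_eq_append)
  moreover have "concat (map (\<lambda>s. [z s..<z (Suc s)]) [m..<n]) = [z m..<z n]"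
    using step.IH mono_on_subset[OF step.prems] by simp
  ultimately show ?case
    using step.hyps by simp
qed

lemma sum_diff_mono_on_nat:
  fixes z :: "nat \<Rightarrow> nat"
  assumes "mono_on {m..n} z" and "m \<le> n"
  shows "(\<Sum>s = m..<n. z (Suc s) - z s) = z n - z m"
  using arg_cong[OF concat_map_upt_mono_on[OF assms], of length]
  by (simp add: length_concat comp_def interv_sum_list_conv_sum_set_nat)

lemma ex_bracketing_index:
  fixes f :: "nat \<Rightarrow> 'a::linorder"
  assumes "m \<le> n" and "f m \<le> a" and "a < f n"
  shows "\<exists>l \<in> {m..<n}. f l \<le> a \<and> a < f (Suc l)"
proof -
  obtain k where "k < n - m" "\<forall>i \<le> k. \<not> a < f (m + i)" "a < f (m + Suc k)"
    using ex_least_nat_less[of "\<lambda>k. a < f (m + k)" "n - m"] assms by (auto simp: not_less)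
  then show ?thesis
    by (intro bexI[of _ "m + k"]) (auto simp: not_less)
qed

lemma sublevel_set_eq_atLeastAtMost:
  fixes f :: "nat \<Rightarrow> 'a::linorder"
  assumes "mono_on {m..n} f" and "l \<in> {m..<n}" and "f l \<le> a" and "a < f (Suc l)"
  shows "{j \<in> {m..n}. f j \<le> a} = {m..l}"
proof (intro equalityI subsetI)
  fix j assume j: "j \<in> {j \<in> {m..n}. f j \<le> a}"
  have "\<not> Suc l \<le> j"
  proof
    assume "Suc l \<le> j"
    then have "f (Suc l) \<le> f j"
      using assms(2) j by (intro mono_onD[OF assms(1)]) auto
    then show False
      using j assms(4) by auto
  qed
  then show "j \<in> {m..l}"
    using j by auto
next
  fix j assume j: "j \<in> {m..l}"
  then have "f j \<le> f l"
    using assms(2) by (intro mono_onD[OF assms(1)]) auto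
  then show "j \<in> {j \<in> {m..n}. f j \<le> a}"
    using j assms(2,3) by auto
qed

lemma length_row_segment [simp]: "length (row_segment A i a b) = b + 1 - a"
  by (simp add: row_segment_def del: upt_Suc)

lemma row_segment_append:
  assumes "a \<le> b + 1" and "b \<le> c"
  shows "row_segment A i a b @ row_segment A i (b + 1) c = row_segment A i a c"
  using upt_add_eq_append[OF assms(1), of "c - b"] assms(2)
  by (simp add: row_segment_def del: upt_Suc flip: map_append)

lemma concat_row_segments:
  assumes "mono_on {1..n + 1} z"
  shows "concat (map (\<lambda>s. row_segment A i (z s + 1) (z (s + 1))) [1..<n + 1]) =
    row_segment A i (z 1 + 1) (z (n + 1))"
proof -
  have "mono_on {1..n + 1} (\<lambda>s. z s + 1)"
    using assms by (simp add: mono_on_def)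
  then have "concat (map (\<lambda>s. [z s + 1..<z (Suc s) + 1]) [1..<n + 1]) =
      [z 1 + 1..<z (n + 1) + 1]"
    by (rule concat_map_upt_mono_on) simp
  from arg_cong[OF this, of "map (entry A i)"] show ?thesis
    by (simp add: row_segment_def map_concat comp_def del: upt_Suc)
qed

lemma mat_of_row_segments:
  assumes "A \<in> carrier_mat m n"
  shows "mat_of_rows_list n (map (\<lambda>i. row_segment A i 1 n) [1..<m + 1]) = A"
  using assms
  by (intro eq_matI)
    (auto simp: mat_of_rows_list_def row_segment_def entry_def simp del: upt_Suc)

definition triangular_block :: "(nat \<Rightarrow> real) \<Rightarrow> (nat \<Rightarrow> real list) \<Rightarrow> nat \<Rightarrow> nat \<Rightarrow> real list" where
  "triangular_block r \<eta> i s =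
     (if i \<le> s then map (\<lambda>c. (\<Prod>t = i..<s. r t) * c) (\<eta> s) else replicate (length (\<eta> s)) 0)"

lemma eq_block_triangularI:
  assumes A: "A \<in> carrier_mat N N"
    and z: "mono_on {1..N + 1} z" "z (N + 1) = N"
    and zero: "\<And>i j. i \<in> {1..N} \<Longrightarrow> j \<in> {1..z 1} \<Longrightarrow> entry A i j = 0"
    and block: "\<And>i s. i \<in> {1..N} \<Longrightarrow> s \<in> {1..N} \<Longrightarrow>
      row_segment A i (z s + 1) (z (s + 1)) = triangular_block r \<eta> i s"
  shows "A = block_triangular N (z 1) r \<eta>"
proof -
  have row: "replicate (z 1) 0 @ concat (map (triangular_block r \<eta> i) [1..<N + 1]) =
      row_segment A i 1 N" if i: "i \<in> {1..N}" for i
  proof -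
    have "replicate (z 1) 0 = row_segment A i 1 (z 1)"
      using zero[OF i]
      by (auto simp: row_segment_def simp del: upt_Suc intro!: replicate_eqI[symmetric])
    moreover have "map (triangular_block r \<eta> i) [1..<N + 1] =
        map (\<lambda>s. row_segment A i (z s + 1) (z (s + 1))) [1..<N + 1]"
      using block[OF i] by (intro map_cong) auto
    moreover have "z 1 \<le> N"
      using mono_onD[OF z(1), of 1 "N + 1"] z(2) by simp
    ultimately show ?thesis
      using concat_row_segments[OF z(1), of A i] row_segment_append[of 1 "z 1" N A i]
      by (simp only: z(2) le_add2)
  qed
  have "block_triangular N (z 1) r \<eta> =
      mat_of_rows_list N (map (\<lambda>i. row_segment A i 1 N) [1..<N + 1])"
    unfolding block_triangular_def triangular_block_def[symmetric]
    by (intro arg_cong[of _ _ "mat_of_rows_list N"] map_cong refl row) auto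
  then show ?thesis
    using mat_of_row_segments[OF A] by simp
qed

lemma dividing_index_end: "dividing_index N x y (N + 1) = N"
  by (simp add: dividing_index_def)

lemma atLeastAtMost_dividing_index:
  assumes y: "mono_on {1..N} y" and i: "i \<in> {1..N}"
  shows "{1..dividing_index N x y i} = {j \<in> {1..N}. y j \<le> x i}"
proof -
  consider (left) "x i < y 1" | (right) "y 1 \<le> x i" "y N \<le> x i" | (between) "y 1 \<le> x i" "x i < y N"
    by linarith
  then show ?thesis
  proof cases
    case left
    have "y 1 \<le> y j" if "j \<in> {1..N}" for j
      using that by (intro mono_onD[OF y]) auto
    then show ?thesis
      using left i by (force simp: dividing_index_def)
  next
    case right
    have "y j \<le> y N" if "j \<in> {1..N}" for j
      using that by (intro mono_onD[OF y]) auto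
    then show ?thesis
      using right i by (force simp: dividing_index_def)
  next
    case between
    let ?bracketing = "\<lambda>l. 1 \<le> l \<and> l + 1 \<le> N \<and> y l \<le> x i \<and> x i < y (l + 1)"
    have sublevel: "{j \<in> {1..N}. y j \<le> x i} = {1..l}" if "?bracketing l" for l
      using that by (intro sublevel_set_eq_atLeastAtMost[OF y]) auto
    have "\<exists>l. ?bracketing l"
      using ex_bracketing_index[of 1 N y "x i"] between i by force
    then obtain l where l: "?bracketing l" ..
    have "(THE l. ?bracketing l) = l"
    proof (rule the_equality[of ?bracketing, OF l])
      fix k assume k: "?bracketing k"
      then show "k = l"
        using sublevel[OF k] sublevel[OF l] by (simp add: Icc_eq_Icc)
    qed
    then have "dividing_index N x y i = l"
      using between i by (simp add: dividing_index_def)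
    then show ?thesis
      using sublevel[OF l] by simp
  qed
qed

lemma dividing_index_le:
  assumes "mono_on {1..N} y" and "i \<in> {1..N + 1}"
  shows "dividing_index N x y i \<le> N"
proof (cases "i = N + 1")
  case True
  show ?thesis
    unfolding True dividing_index_end ..
next
  case False
  then have i: "i \<in> {1..N}"
    using assms(2) by auto
  have "{1..dividing_index N x y i} \<subseteq> {1..N}"
    unfolding atLeastAtMost_dividing_index[OF assms(1) i] by blast
  then show ?thesis by auto
qed

lemma le_dividing_index_iff:
  assumes "mono_on {1..N} y" and "i \<in> {1..N}" and "j \<in> {1..N}"
  shows "j \<le> dividing_index N x y i \<longleftrightarrow> y j \<le> x i"
proof -
  have "j \<in> {1..dividing_index N x y i} \<longleftrightarrow> j \<in> {j \<in> {1..N}. y j \<le> x i}"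
    unfolding atLeastAtMost_dividing_index[OF assms(1,2)] ..
  then show ?thesis
    using assms(3) by simp
qed

lemma mono_on_dividing_index:
  assumes x: "mono_on {1..N} x" and y: "mono_on {1..N} y"
  shows "mono_on {1..N + 1} (dividing_index N x y)"
proof (rule mono_onI)
  fix i j assume ij: "i \<in> {1..N + 1}" "j \<in> {1..N + 1}" "i \<le> j"
  show "dividing_index N x y i \<le> dividing_index N x y j"
  proof (cases "j = N + 1")
    case True
    show ?thesis
      unfolding True dividing_index_end using dividing_index_le[OF y ij(1)] .
  next
    case False
    then have i: "i \<in> {1..N}" and j: "j \<in> {1..N}"
      using ij by auto
    have "x i \<le> x j"
      using mono_onD[OF x i j ij(3)] .
    then have "{1..dividing_index N x y i} \<subseteq> {1..dividing_index N x y j}"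
      unfolding atLeastAtMost_dividing_index[OF y i] atLeastAtMost_dividing_index[OF y j] by auto
    then show ?thesis by auto
  qed
qed

locale sorted_meshes =
  fixes N :: nat and \<epsilon> :: real and x y :: "nat \<Rightarrow> real"
  assumes mono_x: "mono_on {1..N} x" and mono_y: "mono_on {1..N} y"
begin

abbreviation \<zeta> :: "nat \<Rightarrow> nat" where "\<zeta> \<equiv> dividing_index N x y"
abbreviation K\<^sub>U :: "real mat" where "K\<^sub>U \<equiv> upper_block N \<epsilon> x y"
abbreviation r' :: "nat \<Rightarrow> real" where "r' \<equiv> upper_ratio N \<epsilon> x y"
abbreviation \<eta>' :: "nat \<Rightarrow> real list" where "\<eta>' \<equiv> upper_edge N \<epsilon> x y"

lemma upper_block_carrier: "K\<^sub>U \<in> carrier_mat N N"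
  by (simp add: upper_block_def)

lemma mono_on_\<zeta>: "mono_on {1..N + 1} \<zeta>"
  using mono_on_dividing_index[OF mono_x mono_y] .

lemma entry_upper_block:
  assumes i: "i \<in> {1..N}" and j: "j \<in> {1..N}"
  shows "entry K\<^sub>U i j = (if y j \<le> x i then 0 else exp ((x i - y j) / \<epsilon>))"
proof -
  have "i - 1 < N" "j - 1 < N" "Suc (i - 1) = i" "Suc (j - 1) = j"
    using i j by auto
  then show ?thesis
    using le_dividing_index_iff[OF mono_y i j, of x] minus_divide_left[of "y j - x i" \<epsilon>]
    by (auto simp: entry_def upper_block_def kernel_matrix_def)
qed

lemma entry_upper_block_eq_0:
  assumes "i \<in> {1..N}" and "j \<in> {1..\<zeta> i}"
  shows "entry K\<^sub>U i j = 0"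
  using assms(2) entry_upper_block[OF assms(1), of j]
  unfolding atLeastAtMost_dividing_index[OF mono_y assms(1)] by simp

lemma upper_ratio_eq_exp:
  assumes t: "t \<in> {1..<N}" and "x (Suc t) < y N"
  shows "r' t = exp ((x t - x (Suc t)) / \<epsilon>)"
proof -
  have "x t \<le> x (Suc t)"
    using t by (intro mono_onD[OF mono_x]) auto
  then show ?thesis
    using assms by (simp add: upper_ratio_def entry_upper_block flip: exp_diff diff_divide_distrib)
qed

lemma prod_upper_ratio:
  assumes "1 \<le> i" and "i \<le> s" and "s \<le> N" and "x s < y N"
  shows "(\<Prod>t = i..<s. r' t) = exp ((x i - x s) / \<epsilon>)"
  using assms(2-4)
proof (induction s rule: dec_induct)
  case base
  show ?case by simp
next
  case (step s)
  have "x s \<le> x (Suc s)"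
    using step.hyps step.prems \<open>1 \<le> i\<close> by (intro mono_onD[OF mono_x]) auto
  then have "(\<Prod>t = i..<s. r' t) = exp ((x i - x s) / \<epsilon>)"
    using step by auto
  moreover have "r' s = exp ((x s - x (Suc s)) / \<epsilon>)"
    using step.hyps step.prems \<open>1 \<le> i\<close> by (intro upper_ratio_eq_exp) auto
  ultimately show ?case
    using step.hyps by (simp flip: exp_add add_divide_distrib)
qed

lemma entry_upper_block_eq_prod_ratio:
  assumes i: "i \<in> {1..N}" and s: "s \<in> {1..N}" and "i \<le> s" and j: "j \<in> {\<zeta> s + 1..N}"
  shows "entry K\<^sub>U i j = (\<Prod>t = i..<s. r' t) * entry K\<^sub>U s j"
proof -
  have j': "j \<in> {1..N}"
    using j by auto
  have x_less: "x s < y j"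
    using le_dividing_index_iff[OF mono_y s j', of x] j by auto
  also have "y j \<le> y N"
    using j' by (intro mono_onD[OF mono_y]) auto
  finally have "(\<Prod>t = i..<s. r' t) = exp ((x i - x s) / \<epsilon>)"
    using i s \<open>i \<le> s\<close> by (intro prod_upper_ratio) auto
  moreover have "x i \<le> x s"
    using mono_onD[OF mono_x i s \<open>i \<le> s\<close>] .
  ultimately show ?thesis
    using x_less
    by (simp add: entry_upper_block[OF i j'] entry_upper_block[OF s j']
        flip: exp_add add_divide_distrib)
qed

lemma row_segment_upper_block:
  assumes i: "i \<in> {1..N}" and s: "s \<in> {1..N}"
  shows "row_segment K\<^sub>U i (\<zeta> s + 1) (\<zeta> (s + 1)) = triangular_block r' \<eta>' i s"
proof (cases "i \<le> s")
  case True
  have "\<zeta> (s + 1) \<le> N"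
    using s by (intro dividing_index_le[OF mono_y]) auto
  then have "entry K\<^sub>U i j = (\<Prod>t = i..<s. r' t) * entry K\<^sub>U s j"
    if "j \<in> set [\<zeta> s + 1..<\<zeta> (s + 1) + 1]" for j
    using that by (intro entry_upper_block_eq_prod_ratio[OF i s True]) auto
  then show ?thesis
    using True by (simp add: row_segment_def upper_edge_def triangular_block_def del: upt_Suc)
next
  case False
  then have "\<zeta> (s + 1) \<le> \<zeta> i"
    using i s by (intro mono_onD[OF mono_on_\<zeta>]) auto
  then have "entry K\<^sub>U i j = 0" if "j \<in> set [\<zeta> s + 1..<\<zeta> (s + 1) + 1]" for j
    using that by (intro entry_upper_block_eq_0[OF i]) auto
  then show ?thesis
    using False unfolding row_segment_def upper_edge_def triangular_block_def
    by (auto simp del: upt_Suc intro!: replicate_eqI)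
qed

lemma entry_upper_block_left_eq_0:
  assumes i: "i \<in> {1..N}" and j: "j \<in> {1..\<zeta> 1}"
  shows "entry K\<^sub>U i j = 0"
proof -
  have "\<zeta> 1 \<le> \<zeta> i"
    using i by (intro mono_onD[OF mono_on_\<zeta>]) auto
  then show ?thesis
    using j by (intro entry_upper_block_eq_0[OF i]) auto
qed

lemma sum_length_upper_edge: "(\<Sum>i = 1..N. length (\<eta>' i)) = N - \<zeta> 1"
proof -
  have "(\<Sum>i = 1..N. length (\<eta>' i)) = (\<Sum>i = 1..<N + 1. \<zeta> (Suc i) - \<zeta> i)"
    by (intro sum.cong) (auto simp: upper_edge_def)
  also have "\<dots> = \<zeta> (N + 1) - \<zeta> 1"
    by (intro sum_diff_mono_on_nat mono_on_\<zeta>) simp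
  finally show ?thesis
    unfolding dividing_index_end .
qed

lemma upper_block_eq_block_triangular: "K\<^sub>U = block_triangular N (\<zeta> 1) r' \<eta>'"
  by (rule eq_block_triangularI[OF upper_block_carrier mono_on_\<zeta> dividing_index_end
        entry_upper_block_left_eq_0 row_segment_upper_block])

end

theorem theorem2p3:
  fixes N :: nat and \<epsilon> :: real and x y :: "nat \<Rightarrow> real"
  assumes "N \<ge> 1" and "\<epsilon> > 0"
    and "strict_mono_on {1..N} x" and "strict_mono_on {1..N} y"
  shows "int (\<Sum>i = 1..N. length (upper_edge N \<epsilon> x y i)) = int N - int (dividing_index N x y 1)
    \<and> upper_block N \<epsilon> x y =
        block_triangular N (dividing_index N x y 1) (upper_ratio N \<epsilon> x y) (upper_edge N \<epsilon> x y)
    \<and> (\<forall>i \<in> {1..N}. \<forall>s \<in> {1..N}.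
        row_segment (upper_block N \<epsilon> x y) i
            (dividing_index N x y s + 1) (dividing_index N x y (s + 1)) =
          (if s \<ge> i
           then map (\<lambda>c. (\<Prod>t = i..<s. upper_ratio N \<epsilon> x y t) * c) (upper_edge N \<epsilon> x y s)
           else replicate (length (upper_edge N \<epsilon> x y s)) 0))
    \<and> (\<forall>i \<in> {1..N}. \<forall>j \<in> {1..dividing_index N x y 1}. entry (upper_block N \<epsilon> x y) i j = 0)"
proof -
  interpret sorted_meshes N \<epsilon> x y
    using assms(3,4) by (intro sorted_meshes.intro strict_mono_on_imp_mono_on)
  have "\<zeta> 1 \<le> N"
    by (rule dividing_index_le[OF mono_y]) simp
  then have "int (\<Sum>i = 1..N. length (\<eta>' i)) = int N - int (\<zeta> 1)"
    unfolding sum_length_upper_edge by (rule of_nat_diff)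
  moreover note upper_block_eq_block_triangular
  moreover have "\<forall>i \<in> {1..N}. \<forall>s \<in> {1..N}.
      row_segment K\<^sub>U i (\<zeta> s + 1) (\<zeta> (s + 1)) =
        (if s \<ge> i then map (\<lambda>c. (\<Prod>t = i..<s. r' t) * c) (\<eta>' s)
         else replicate (length (\<eta>' s)) 0)"
    using row_segment_upper_block unfolding triangular_block_def by blast
  moreover have "\<forall>i \<in> {1..N}. \<forall>j \<in> {1..\<zeta> 1}. entry K\<^sub>U i j = 0"
    using entry_upper_block_left_eq_0 by blast
  ultimately show ?thesis by blast
qed

end
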